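(* Let $\mathbb{K}$ be a field with $\operatorname{char}(\mathbb{K})\neq 2$ and let $n$ be a positive integer. Then the $n\times n$ determinant tensor $\det_n$ over $\mathbb{K}$ satisfies $$\operatorname{Crank}(\det\nolimits_n)\le\operatorname{rank}(\det\nolimits_n)\le\frac{n!}{2^{\lfloor (n-2)/2\rfloor}}.$$
   Context: Let $V$ be a $\mathbb{K}$-vector space of dimension $n$ and $\{e_1,\dots,e_n\}$ a basis of $V^*$. The determinant tensor is $$\det\nolimits_n=\sum_{\sigma\in S_n}\operatorname{sgn}(\sigma)\,e_{\sigma(1)}\otimes e_{\sigma(2)}\otimes\cdots\otimes e_{\sigma(n)}\in(V^* )^{\otimes n},$$ where $S_n$ is the symmetric group on $n$ letters. Tensor rank: for finite-dimensional $\mathbb{K}$-vector spaces $V_1,\dots,V_d$ and $\mathcal{T}\in V_1\otimes\cdots\otimes V_d$, $\operatorname{rank}(\mathcal{T})$ is the smallest $r$ such that $\mathcal{T}=\sum_{i=1}^r v_{i,1}\otimes v_{i,2}\otimes\cdots\otimes v_{i,d}$ with $v_{i,j}\in V_j$ for all $i,j$. The quantity $\operatorname{rank}(\det_n)$ is the tensor rank of $\det_n$ as an element of $(V^* )^{\otimes n}$. Chow rank: for a nonzero homogeneous polynomial $f$ of degree $d$ over $\mathbb{K}$ in finitely many variables, $\operatorname{Crank}(f)$ is the smallest $r$ such that $f=\sum_{i=1}^r l_{i,1}l_{i,2}\cdots l_{i,d}$, where each $l_{i,j}$ is a homogeneous polynomial of degree $1$ over $\mathbb{K}$ in the same variables.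 The quantity $\operatorname{Crank}(\det_n)$ is the Chow rank of $\det_n$ viewed as a homogeneous polynomial of degree $n$ in $n^2$ independent variables $x_{i,j}$ ($1\le i,j\le n$), namely the determinant $\sum_{\sigma\in S_n}\operatorname{sgn}(\sigma)\prod_{i=1}^n x_{i,\sigma(i)}$ of the generic matrix $(x_{i,j})$. *)

theory Defs
  imports
    "HOL-Library.Poly_Mapping"
    "HOL-Library.Function_Algebras"
    "HOL-Computational_Algebra.Computational_Algebra"
    "HOL-Combinatorics.Permutations"
begin

definition dual_space :: "('k::field \<Rightarrow> 'v::ab_group_add \<Rightarrow> 'v) \<Rightarrow> ('v \<Rightarrow> 'k) set" where
  "dual_space scale = {\<phi>. Vector_Spaces.linear scale (*) \<phi>}"

definition scale_fun :: "'k::field \<Rightarrow> ('v \<Rightarrow> 'k) \<Rightarrow> ('v \<Rightarrow> 'k)" where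
  "scale_fun c \<phi> = (\<lambda>v. c * \<phi> v)"

text \<open>The family \<open>e 1, \<dots>, e n\<close> (only these values of \<open>e\<close> matter) is a basis of the dual space;
  functions carry the pointwise vector space structure.\<close>

definition dual_basis ::
    "('k::field \<Rightarrow> 'v::ab_group_add \<Rightarrow> 'v) \<Rightarrow> nat \<Rightarrow> (nat \<Rightarrow> 'v \<Rightarrow> 'k) \<Rightarrow> bool" where
  "dual_basis scale n e \<longleftrightarrow>
     inj_on e {1..n} \<and>
     \<not> module.dependent scale_fun (e ` {1..n}) \<and>
     module.span scale_fun (e ` {1..n}) = dual_space scale"

text \<open>
  Let \<open>W 1, \<dots>, W d\<close> be vector spaces of \<open>'k\<close>-valued functions on \<open>'v\<close>. The linear map
  sending \<open>w 1 \<otimes> \<dots> \<otimes> w d\<close> to the function \<open>(x 1, \<dots>, x d) \<mapsto> w 1 (x 1) * \<dots> * w d (x d)\<close> is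
  an injection on the tensor product of the \<open>W j\<close>, and tensors are identified with their images.
  For \<open>W j = V\<^sup>*\<close>, with \<open>V\<close> of finite dimension, this is the usual identification of the
  \<open>d\<close>-th tensor power of \<open>V\<^sup>*\<close> with the \<open>d\<close>-linear forms on \<open>V\<close>. Argument tuples are
  functions on \<open>nat\<close>, of which only the values at \<open>1, \<dots>, d\<close> are used.
\<close>

definition pure_tensor :: "nat \<Rightarrow> (nat \<Rightarrow> 'v \<Rightarrow> 'k::field) \<Rightarrow> ((nat \<Rightarrow> 'v) \<Rightarrow> 'k)" where
  "pure_tensor d w = (\<lambda>x. \<Prod>j = 1..d. w j (x j))"

definition tensor_rank ::
    "(nat \<Rightarrow> ('v \<Rightarrow> 'k::field) set) \<Rightarrow> nat \<Rightarrow> ((nat \<Rightarrow> 'v) \<Rightarrow> 'k) \<Rightarrow> nat" where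
  "tensor_rank W d T =
     (LEAST r. \<exists>w :: nat \<Rightarrow> nat \<Rightarrow> 'v \<Rightarrow> 'k.
        (\<forall>i\<in>{1..r}. \<forall>j\<in>{1..d}. w i j \<in> W j) \<and>
        T = (\<Sum>i = 1..r. pure_tensor d (w i)))"

definition det_tensor :: "nat \<Rightarrow> (nat \<Rightarrow> 'v \<Rightarrow> 'k::field) \<Rightarrow> ((nat \<Rightarrow> 'v) \<Rightarrow> 'k)" where
  "det_tensor n e =
     (\<Sum>\<sigma> | \<sigma> permutes {1..n}. scale_fun (of_int (sign \<sigma>)) (pure_tensor n (\<lambda>j. e (\<sigma> j))))"

text \<open>Polynomials in variables of type \<open>'x\<close>: finitely supported maps from exponent vectors to
  coefficients, multiplied by convolution.\<close>

type_synonym ('x, 'k) poly_in = "('x \<Rightarrow>\<^sub>0 nat) \<Rightarrow>\<^sub>0 'k"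

definition Var :: "'x \<Rightarrow> ('x, 'k::field) poly_in" where
  "Var x = Poly_Mapping.single (Poly_Mapping.single x 1) 1"

text \<open>As usual, the zero polynomial is homogeneous of every degree.\<close>

definition homogeneous :: "'x set \<Rightarrow> nat \<Rightarrow> ('x, 'k::field) poly_in \<Rightarrow> bool" where
  "homogeneous X d p \<longleftrightarrow>
     (\<forall>m \<in> Poly_Mapping.keys p. Poly_Mapping.keys m \<subseteq> X \<and>
        (\<Sum>x \<in> Poly_Mapping.keys m. Poly_Mapping.lookup m x) = d)"

definition chow_rank :: "'x set \<Rightarrow> nat \<Rightarrow> ('x, 'k::field) poly_in \<Rightarrow> nat" where
  "chow_rank X d f =
     (LEAST r. \<exists>l :: nat \<Rightarrow> nat \<Rightarrow> ('x, 'k) poly_in.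
        (\<forall>i\<in>{1..r}. \<forall>j\<in>{1..d}. homogeneous X 1 (l i j)) \<and>
        f = (\<Sum>i = 1..r. \<Prod>j = 1..d. l i j))"

definition det_poly :: "nat \<Rightarrow> (nat \<times> nat, 'k::field) poly_in" where
  "det_poly n = (\<Sum>\<sigma> | \<sigma> permutes {1..n}. of_int (sign \<sigma>) * (\<Prod>i = 1..n. Var (i, \<sigma> i)))"

end

theory Submission
  imports Defs
begin

text \<open>
  Put \<open>k = \<lfloor>n / 2\<rfloor>\<close> and group the first \<open>2 k\<close> slots into \<open>k\<close> consecutive pairs. With
  \<open>\<omega> = a \<otimes> b - b \<otimes> a\<close> and \<open>\<delta> = a \<otimes> a - b \<otimes> b\<close> one has \<open>(a + b) \<otimes> (a - b) = \<delta> - \<omega>\<close> and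
  \<open>(a - b) \<otimes> (a + b) = \<delta> + \<omega>\<close>. Laplace expansion writes \<open>det\<^sub>n\<close> as an alternating sum of
  products of \<open>k\<close> factors \<open>\<omega>\<close> (and one more form if \<open>n\<close> is odd) over the \<open>n! / 2\<^sup>k\<close> permutations
  that are increasing on each pair. Replace each product by the combination
  \<open>(-1)\<^sup>k \<Prod>(\<delta> - \<omega>) + \<Prod>(\<delta> + \<omega>)\<close> of two pure tensors: the terms with an odd number of factors
  \<open>\<delta>\<close> cancel, those without \<open>\<delta>\<close> double, and those with at least two factors \<open>\<delta>\<close> vanish after
  alternation. So \<open>2 det\<^sub>n\<close> is a sum of \<open>2 n! / 2\<^sup>k\<close> pure tensors.

  For the Chow rank, evaluate a decomposition of the tensor at the vectors dual to the basis and
  turn the resulting coefficient of \<open>e\<^sub>a\<close> in slot \<open>j\<close> into the coefficient of \<open>x\<^sub>j\<^sub>a\<close>.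
\<close>

section \<open>Alternating sums over permutations increasing on pairs\<close>

text \<open>For \<open>2*k \<le> n\<close> these are the sorted representatives of the cosets
  \<open>\<sigma> H\<close>, where \<open>H\<close> is generated by the swaps of the first
  \<open>k\<close> pairs. Pairs are numbered from 0, slots from 1.\<close>

definition paired_perms :: "nat \<Rightarrow> nat \<Rightarrow> (nat \<Rightarrow> nat) set" where
  "paired_perms n k = {\<sigma>. \<sigma> permutes {1..n} \<and> (\<forall>j<k. \<sigma> (2*j+1) < \<sigma> (2*j+2))}"

definition pair_swap :: "nat \<Rightarrow> nat \<Rightarrow> nat" where
  "pair_swap j = transpose (2*j+1) (2*j+2)"

lemma pair_swap_apply [simp]:
  "pair_swap i (Suc (2*j)) = (if i = j then Suc (Suc (2*j)) else Suc (2*j))"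
  "pair_swap i (Suc (Suc (2*j))) = (if i = j then Suc (2*j) else Suc (Suc (2*j)))"
  by (auto simp: pair_swap_def transpose_def)

lemma pair_swap_beyond: "2*j+2 < l \<Longrightarrow> pair_swap j l = l"
  by (simp add: pair_swap_def transpose_def)

lemma pair_swap_involutory [simp]: "pair_swap j (pair_swap j l) = l"
  by (simp add: pair_swap_def)

lemma pair_swap_permutes: "2*j+2 \<le> n \<Longrightarrow> pair_swap j permutes {1..n}"
  unfolding pair_swap_def by (intro permutes_swap_id) auto

lemma paired_perms_0: "paired_perms n 0 = {\<sigma>. \<sigma> permutes {1..n}}"
  by (simp add: paired_perms_def)

lemma finite_paired_perms [simp]: "finite (paired_perms n k)"
  by (rule finite_subset[OF _ finite_permutations[of "{1..n}"]]) (auto simp: paired_perms_def)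

text \<open>Composition with \<open>pair_swap k\<close> is an involution that exchanges the
  permutations increasing on pair \<open>k\<close> with those decreasing on it and leaves the values
  on earlier pairs alone. So the larger set is two disjoint copies of the smaller one.\<close>

lemma sum_paired_perms_Suc:
  fixes f :: "(nat \<Rightarrow> nat) \<Rightarrow> 'a::comm_monoid_add"
  assumes "2*k+2 \<le> n"
  shows "sum f (paired_perms n k) = (\<Sum>\<sigma>\<in>paired_perms n (Suc k). f \<sigma> + f (\<sigma> \<circ> pair_swap k))"
proof -
  let ?s = "\<lambda>\<sigma>. \<sigma> \<circ> pair_swap k"
  have swap: "pair_swap k permutes {1..n}"
    using assms by (rule pair_swap_permutes)
  have ss: "?s (?s \<sigma>) = \<sigma>" for \<sigma> :: "nat \<Rightarrow> nat"
    by (simp add: fun_eq_iff)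
  have mem: "?s \<sigma> \<in> paired_perms n k" if "\<sigma> \<in> paired_perms n k" for \<sigma>
  proof -
    have "?s \<sigma> (2*j+1) < ?s \<sigma> (2*j+2)" if "j < k" for j
      using that \<open>\<sigma> \<in> _\<close> by (simp add: paired_perms_def)
    then show ?thesis
      using that permutes_compose[OF swap, of \<sigma>] by (simp add: paired_perms_def)
  qed
  have sub: "paired_perms n (Suc k) \<subseteq> paired_perms n k"
    by (auto simp: paired_perms_def)
  have Suc_iff: "\<sigma> \<in> paired_perms n (Suc k) \<longleftrightarrow> \<sigma> (2*k+1) < \<sigma> (2*k+2)"
    if "\<sigma> \<in> paired_perms n k" for \<sigma>
    using that by (auto simp: paired_perms_def less_Suc_eq)
  \<comment> \<open>Injectivity excludes ties, so not increasing on the pair means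
    decreasing.\<close>
  have neq: "\<sigma> (2*k+1) \<noteq> \<sigma> (2*k+2)" if "\<sigma> \<in> paired_perms n k" for \<sigma>
    using that permutes_inj[of \<sigma> "{1..n}"] by (auto simp: paired_perms_def dest: injD)
  have flip: "?s \<sigma> \<in> paired_perms n (Suc k) \<longleftrightarrow> \<sigma> \<notin> paired_perms n (Suc k)"
    if "\<sigma> \<in> paired_perms n k" for \<sigma>
    using neq[OF that] unfolding Suc_iff[OF that] Suc_iff[OF mem[OF that]] by auto
  have un: "paired_perms n k = paired_perms n (Suc k) \<union> ?s ` paired_perms n (Suc k)"
  proof (intro equalityI subsetI)
    fix \<sigma> assume "\<sigma> \<in> paired_perms n k"
    then show "\<sigma> \<in> paired_perms n (Suc k) \<union> ?s ` paired_perms n (Suc k)"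
      using flip[of \<sigma>] ss[of \<sigma>] by (metis UnCI image_eqI)
  qed (use sub mem in blast)
  have disj: "paired_perms n (Suc k) \<inter> ?s ` paired_perms n (Suc k) = {}"
    using flip sub by blast
  have inj: "inj_on ?s (paired_perms n (Suc k))"
    by (metis ss inj_onI)
  show ?thesis
    by (subst un, subst sum.union_disjoint)
      (use disj inj in \<open>simp_all add: sum.reindex sum.distrib o_def\<close>)
qed

text \<open>A summand invariant under the \<open>k\<close> swaps is constant on cosets of size
  \<open>2^k\<close>; each induction step merges the two halves of one more pair.\<close>

lemma sum_permutations_eq_power_paired:
  fixes g :: "(nat \<Rightarrow> nat) \<Rightarrow> 'a::comm_semiring_1"
  assumes "2*k \<le> n"
    and "\<And>\<sigma> j. \<sigma> permutes {1..n} \<Longrightarrow> j < k \<Longrightarrow> g (\<sigma> \<circ> pair_swap j) = g \<sigma>"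
  shows "(\<Sum>\<sigma> | \<sigma> permutes {1..n}. g \<sigma>) = 2^k * sum g (paired_perms n k)"
  using assms
proof (induction k)
  case 0
  then show ?case by (simp add: paired_perms_0)
next
  case (Suc k)
  have "sum g (paired_perms n k) = (\<Sum>\<sigma>\<in>paired_perms n (Suc k). g \<sigma> + g (\<sigma> \<circ> pair_swap k))"
    using Suc.prems by (intro sum_paired_perms_Suc) auto
  also have "\<dots> = (\<Sum>\<sigma>\<in>paired_perms n (Suc k). 2 * g \<sigma>)"
    using Suc.prems(2)[of _ k, OF _ lessI]
    by (intro sum.cong refl) (simp only: paired_perms_def mem_Collect_eq mult_2)
  finally show ?case
    using Suc by (simp add: sum_distrib_left mult_ac)
qed

lemma card_paired_perms:
  assumes "2*k \<le> n"
  shows "2^k * card (paired_perms n k) = fact n"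
  using sum_permutations_eq_power_paired[OF assms, of "\<lambda>_. 1::nat"]
    card_permutations[of "{1..n}" n]
  by simp

section \<open>Signs and cancellation in alternating sums\<close>

lemma sign_permutes_comp_transpose:
  fixes n :: nat
  assumes "\<sigma> permutes {1..n}" "p \<noteq> q"
  shows "sign (\<sigma> \<circ> transpose p q) = - sign \<sigma>"
proof -
  have "permutation \<sigma>"
    by (rule permutes_imp_permutation[OF _ assms(1)]) simp
  then show ?thesis
    using assms(2) by (simp add: sign_compose permutation_swap_id sign_swap_id)
qed

lemma sign_permutes_comp_pair_swap:
  "\<sigma> permutes {1..n} \<Longrightarrow> sign (\<sigma> \<circ> pair_swap j) = - sign \<sigma>"
  unfolding pair_swap_def by (rule sign_permutes_comp_transpose) auto

text \<open>Reindexing by the transposition negates the sign and keeps \<open>h\<close>, so the sum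
  is its own negative. Since 2 is not 0, it vanishes.\<close>

lemma alternating_sum_eq_0:
  fixes h :: "(nat \<Rightarrow> nat) \<Rightarrow> 'a::idom"
  assumes "(2::'a) \<noteq> 0" and pq: "p \<in> {1..n}" "q \<in> {1..n}" "p \<noteq> q"
    and h: "\<And>\<sigma>. h (\<sigma> \<circ> transpose p q) = h \<sigma>"
  shows "(\<Sum>\<sigma> | \<sigma> permutes {1..n}. of_int (sign \<sigma>) * h \<sigma>) = 0" (is "?S = 0")
proof -
  have "?S = (\<Sum>\<sigma> | \<sigma> permutes {1..n}. of_int (sign (\<sigma> \<circ> transpose p q)) * h (\<sigma> \<circ> transpose p q))"
    by (rule sum_permutations_compose_right[OF permutes_swap_id[OF pq(1,2)]])
  also have "\<dots> = (\<Sum>\<sigma> | \<sigma> permutes {1..n}. - (of_int (sign \<sigma>) * h \<sigma>))"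
    using sign_permutes_comp_transpose[OF _ pq(3)] by (intro sum.cong) (auto simp: h)
  also have "\<dots> = - ?S"
    by (simp add: sum_negf)
  finally have "2 * ?S = 0"
    by (simp only: mult_2 add_eq_0_iff2)
  then show ?thesis using assms(1) by simp
qed

text \<open>The factor \<omega>, with \<open>E i a\<close> standing for the value of the form with
  index \<open>a\<close> in slot \<open>i\<close>: the 2 by 2 minor of rows \<open>2*j+1\<close>,
  \<open>2*j+2\<close> in the columns that \<sigma> assigns to them.\<close>

definition wedge_pair :: "(nat \<Rightarrow> nat \<Rightarrow> 'a::comm_ring_1) \<Rightarrow> (nat \<Rightarrow> nat) \<Rightarrow> nat \<Rightarrow> 'a" where
  "wedge_pair E \<sigma> j = E (2*j+1) (\<sigma> (2*j+1)) * E (2*j+2) (\<sigma> (2*j+2))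
     - E (2*j+1) (\<sigma> (2*j+2)) * E (2*j+2) (\<sigma> (2*j+1))"

text \<open>The factor \<delta>: both slots of the pair carry the same index.\<close>

definition diag_pair :: "(nat \<Rightarrow> nat \<Rightarrow> 'a::comm_ring_1) \<Rightarrow> (nat \<Rightarrow> nat) \<Rightarrow> nat \<Rightarrow> 'a" where
  "diag_pair E \<sigma> j = E (2*j+1) (\<sigma> (2*j+1)) * E (2*j+2) (\<sigma> (2*j+1))
     - E (2*j+1) (\<sigma> (2*j+2)) * E (2*j+2) (\<sigma> (2*j+2))"

lemma wedge_pair_swap:
  "wedge_pair E (\<sigma> \<circ> pair_swap i) j = (if i = j then - wedge_pair E \<sigma> j else wedge_pair E \<sigma> j)"
  by (simp add: wedge_pair_def)

lemma diag_pair_swap: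
  "diag_pair E (\<sigma> \<circ> pair_swap i) j = (if i = j then - diag_pair E \<sigma> j else diag_pair E \<sigma> j)"
  by (simp add: diag_pair_def)

lemma prod_pairs:
  fixes f :: "nat \<Rightarrow> 'a::comm_monoid_mult"
  assumes "2*k \<le> n"
  shows "prod f {1..n} = (\<Prod>j<k. f (2*j+1) * f (2*j+2)) * prod f {2*k+1..n}"
  using assms
proof (induction k)
  case (Suc k)
  have "{2*k+1..n} = insert (2*k+1) (insert (2*k+2) {2*Suc k+1..n})"
    using Suc.prems by auto
  then have "prod f {2*k+1..n} = f (2*k+1) * f (2*k+2) * prod f {2*Suc k+1..n}"
    by (simp add: mult.assoc)
  then show ?case using Suc by (simp add: mult.assoc)
qed simp

text \<open>Laplace expansion along pairs of rows. The terms of \<sigma> and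
  \<open>\<sigma> \<circ> pair_swap k\<close> differ only in the sign and in the entries of rows
  \<open>2*k+1\<close> and \<open>2*k+2\<close>, and together they form the minor of these
  rows.\<close>

lemma det_eq_sum_wedge_pairs:
  fixes E :: "nat \<Rightarrow> nat \<Rightarrow> 'a::comm_ring_1"
  assumes "2*k \<le> n"
  shows "(\<Sum>\<sigma> | \<sigma> permutes {1..n}. of_int (sign \<sigma>) * (\<Prod>i=1..n. E i (\<sigma> i)))
    = (\<Sum>\<sigma>\<in>paired_perms n k. of_int (sign \<sigma>) *
        ((\<Prod>j<k. wedge_pair E \<sigma> j) * (\<Prod>i=2*k+1..n. E i (\<sigma> i))))"
  using assms
proof (induction k)
  case 0
  then show ?case by (simp add: paired_perms_0)
next
  case (Suc k)
  let ?f = "\<lambda>k \<sigma>. of_int (sign \<sigma>) * ((\<Prod>j<k. wedge_pair E \<sigma> j) * (\<Prod>i=2*k+1..n. E i (\<sigma> i)))"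
  have "sum (?f k) (paired_perms n k)
    = (\<Sum>\<sigma>\<in>paired_perms n (Suc k). ?f k \<sigma> + ?f k (\<sigma> \<circ> pair_swap k))"
    using Suc.prems by (intro sum_paired_perms_Suc) auto
  also have "\<dots> = sum (?f (Suc k)) (paired_perms n (Suc k))"
  proof (rule sum.cong)
    fix \<sigma> assume "\<sigma> \<in> paired_perms n (Suc k)"
    then have sg: "sign (\<sigma> \<circ> pair_swap k) = - sign \<sigma>"
      by (intro sign_permutes_comp_pair_swap[of _ n]) (auto simp: paired_perms_def)
    have w: "(\<Prod>j<k. wedge_pair E (\<sigma> \<circ> pair_swap k) j) = (\<Prod>j<k. wedge_pair E \<sigma> j)"
      by (intro prod.cong) (auto simp: wedge_pair_swap)
    have "{2*k+1..n} = insert (2*k+1) (insert (2*k+2) {2*Suc k+1..n})"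
      using Suc.prems by auto
    then have r: "(\<Prod>i=2*k+1..n. E i (\<tau> i)) = E (2*k+1) (\<tau> (2*k+1)) * E (2*k+2) (\<tau> (2*k+2)) *
        (\<Prod>i=2*Suc k+1..n. E i (\<tau> i))" for \<tau>
      by (simp add: mult.assoc)
    have t: "(\<Prod>i=2*Suc k+1..n. E i ((\<sigma> \<circ> pair_swap k) i)) = (\<Prod>i=2*Suc k+1..n. E i (\<sigma> i))"
      by (intro prod.cong) (auto simp: pair_swap_beyond)
    show "?f k \<sigma> + ?f k (\<sigma> \<circ> pair_swap k) = ?f (Suc k) \<sigma>"
      unfolding r t w sg by (simp add: wedge_pair_def) (simp add: algebra_simps)
  qed simp
  finally show ?case using Suc by simp
qed

text \<open>Every monomial here repeats two indices, hence misses two others, and is fixed by the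
  transposition of the two missing ones.\<close>

lemma sum_two_diag_pairs_eq_0:
  fixes E :: "nat \<Rightarrow> nat \<Rightarrow> 'a::idom"
  assumes two: "(2::'a) \<noteq> 0" and n: "2*k \<le> n"
    and ij: "i < k" "j < k" "i \<noteq> j" "i \<notin> S" "j \<notin> S"
  shows "(\<Sum>\<sigma> | \<sigma> permutes {1..n}. of_int (sign \<sigma>) *
      ((\<Prod>l\<in>S. wedge_pair E \<sigma> l) * (\<Prod>l\<in>{..<k} - S. diag_pair E \<sigma> l) *
       (\<Prod>l=2*k+1..n. E l (\<sigma> l)))) = 0"
proof -
  \<comment> \<open>All factors away from pairs \<open>i\<close> and \<open>j\<close>; they do not
    see a transposition of a slot of pair \<open>i\<close> with one of pair
    \<open>j\<close>.\<close>
  define X where "X \<sigma> = (\<Prod>l\<in>S. wedge_pair E \<sigma> l) * (\<Prod>l\<in>{..<k} - S - {i,j}. diag_pair E \<sigma> l) *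
       (\<Prod>l=2*k+1..n. E l (\<sigma> l))" for \<sigma>
  define \<phi> where "\<phi> l a = E (2*l+1) a * E (2*l+2) a" for l a
  have X: "X (\<sigma> \<circ> transpose p q) = X \<sigma>"
    if "p \<in> {2*i+1,2*i+2}" "q \<in> {2*j+1,2*j+2}" for \<sigma> p q
  proof -
    have ne: "2*l+1 \<noteq> p" "2*l+2 \<noteq> p" "2*l+1 \<noteq> q" "2*l+2 \<noteq> q" if "l \<noteq> i" "l \<noteq> j" for l
      using that \<open>p \<in> _\<close> \<open>q \<in> _\<close> by simp_all presburger+
    have w: "wedge_pair E (\<sigma> \<circ> transpose p q) l = wedge_pair E \<sigma> l"
      and d: "diag_pair E (\<sigma> \<circ> transpose p q) l = diag_pair E \<sigma> l" if "l \<noteq> i" "l \<noteq> j" for l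
      using ne[OF that] by (simp_all add: wedge_pair_def diag_pair_def transpose_def)
    show ?thesis
      unfolding X_def
    proof (intro arg_cong2[where f = times] prod.cong refl)
      fix l assume "l \<in> {2*k+1..n}"
      then have "l \<noteq> p" "l \<noteq> q"
        using that ij by auto
      then show "E l ((\<sigma> \<circ> transpose p q) l) = E l (\<sigma> l)"
        by (simp add: transpose_def)
    next
      fix l assume "l \<in> S"
      then show "wedge_pair E (\<sigma> \<circ> transpose p q) l = wedge_pair E \<sigma> l"
        using ij by (intro w) auto
    next
      fix l assume "l \<in> {..<k} - S - {i,j}"
      then show "diag_pair E (\<sigma> \<circ> transpose p q) l = diag_pair E \<sigma> l"
        by (intro d) auto
    qed
  qed
  \<comment> \<open>In pairs \<open>i\<close> and \<open>j\<close> the monomial uses only the values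
    of \<sigma> at \<open>p\<close> and \<open>q\<close>. Their partners \<open>p'\<close> and
    \<open>q'\<close> can be transposed without changing it.\<close>
  have z: "(\<Sum>\<sigma> | \<sigma> permutes {1..n}. of_int (sign \<sigma>) * (\<phi> i (\<sigma> p) * \<phi> j (\<sigma> q) * X \<sigma>)) = 0"
    if "(p, p') = (2*i+1, 2*i+2) \<or> (p, p') = (2*i+2, 2*i+1)"
      "(q, q') = (2*j+1, 2*j+2) \<or> (q, q') = (2*j+2, 2*j+1)" for p q p' q'
  proof (rule alternating_sum_eq_0[OF two, of p' n q'])
    have ne: "p \<noteq> p'" "p \<noteq> q'" "q \<noteq> p'" "q \<noteq> q'" "p' \<noteq> q'"
      using that ij(3) unfolding prod.inject by presburger+
    show "p' \<in> {1..n}" "q' \<in> {1..n}" "p' \<noteq> q'"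
      using that ij n ne by auto
    show "\<phi> i ((\<sigma> \<circ> transpose p' q') p) * \<phi> j ((\<sigma> \<circ> transpose p' q') q) * X (\<sigma> \<circ> transpose p' q')
        = \<phi> i (\<sigma> p) * \<phi> j (\<sigma> q) * X \<sigma>" for \<sigma>
      using X[of p' q' \<sigma>] ne that by (auto simp: transpose_def)
  qed
  have split: "(\<Prod>l\<in>{..<k} - S. diag_pair E \<sigma> l)
      = diag_pair E \<sigma> i * (diag_pair E \<sigma> j * (\<Prod>l\<in>{..<k} - S - {i,j}. diag_pair E \<sigma> l))" for \<sigma>
  proof -
    have "{..<k} - S = insert i (insert j ({..<k} - S - {i,j}))"
      using ij by auto
    then show ?thesis
      using ij by (metis (no_types, lifting) Diff_iff finite_Diff finite_insert finite_lessThan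
          insertCI insertE prod.insert)
  qed
  have d: "diag_pair E \<sigma> l = \<phi> l (\<sigma> (2*l+1)) - \<phi> l (\<sigma> (2*l+2))" for \<sigma> l
    by (simp add: diag_pair_def \<phi>_def)
  \<comment> \<open>Each of the two \<delta> is a difference of two values of \<phi>; multiplying
    out leaves four terms, each of the kind treated by \<open>z\<close>.\<close>
  have "of_int (sign \<sigma>) *
      ((\<Prod>l\<in>S. wedge_pair E \<sigma> l) * (\<Prod>l\<in>{..<k} - S. diag_pair E \<sigma> l) *
       (\<Prod>l=2*k+1..n. E l (\<sigma> l)))
     = of_int (sign \<sigma>) * (\<phi> i (\<sigma> (2*i+1)) * \<phi> j (\<sigma> (2*j+1)) * X \<sigma>)
     - of_int (sign \<sigma>) * (\<phi> i (\<sigma> (2*i+1)) * \<phi> j (\<sigma> (2*j+2)) * X \<sigma>)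
     - of_int (sign \<sigma>) * (\<phi> i (\<sigma> (2*i+2)) * \<phi> j (\<sigma> (2*j+1)) * X \<sigma>)
     + of_int (sign \<sigma>) * (\<phi> i (\<sigma> (2*i+2)) * \<phi> j (\<sigma> (2*j+2)) * X \<sigma>)" for \<sigma>
    unfolding split X_def d[of \<sigma> i] d[of \<sigma> j] by (simp add: algebra_simps)
  then show ?thesis
    by (simp only: sum.distrib sum_subtractf z[OF disjI1[OF refl] disjI1[OF refl]]
        z[OF disjI1[OF refl] disjI2[OF refl]] z[OF disjI2[OF refl] disjI1[OF refl]]
        z[OF disjI2[OF refl] disjI2[OF refl]]) simp
qed

text \<open>A swap of a pair negates the sign and exactly one factor, that of the swapped pair. So
  the summand is invariant, and its vanishing sum over all permutations is \<open>2^k\<close> times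
  this one.\<close>

lemma sum_paired_two_diag_pairs_eq_0:
  fixes E :: "nat \<Rightarrow> nat \<Rightarrow> 'a::idom"
  assumes two: "(2::'a) \<noteq> 0" and n: "2*k \<le> n" and S: "S \<subseteq> {..<k}"
    and ij: "i < k" "j < k" "i \<noteq> j" "i \<notin> S" "j \<notin> S"
  shows "(\<Sum>\<sigma>\<in>paired_perms n k. of_int (sign \<sigma>) *
      ((\<Prod>l\<in>S. wedge_pair E \<sigma> l) * (\<Prod>l\<in>{..<k} - S. diag_pair E \<sigma> l) *
       (\<Prod>l=2*k+1..n. E l (\<sigma> l)))) = 0" (is "sum ?g _ = 0")
proof -
  have "?g (\<sigma> \<circ> pair_swap j) = ?g \<sigma>" if "\<sigma> permutes {1..n}" "j < k" for \<sigma> j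
  proof -
    have fS: "finite S" using S finite_subset by blast
    have sg: "sign (\<sigma> \<circ> pair_swap j) = - sign \<sigma>"
      using that(1) by (rule sign_permutes_comp_pair_swap)
    have r: "(\<Prod>l=2*k+1..n. E l ((\<sigma> \<circ> pair_swap j) l)) = (\<Prod>l=2*k+1..n. E l (\<sigma> l))"
      using that by (intro prod.cong) (auto simp: pair_swap_beyond)
    have neg: "(\<Prod>l\<in>A. if j = l then - f l else f l) = (if j \<in> A then -1 else 1) * prod f A"
      if "finite A" for A and f :: "nat \<Rightarrow> 'a"
      using that by (induction A) auto
    show ?thesis
      unfolding wedge_pair_swap diag_pair_swap sg r neg[OF fS] neg[OF finite_Diff[OF finite_lessThan]]
      using that by auto
  qed
  then have "(\<Sum>\<sigma> | \<sigma> permutes {1..n}. ?g \<sigma>) = 2^k * sum ?g (paired_perms n k)"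
    by (rule sum_permutations_eq_power_paired[OF n])
  then have "2^k * sum ?g (paired_perms n k) = 0"
    unfolding sum_two_diag_pairs_eq_0[OF two n ij] by (rule sym)
  then show ?thesis using two by simp
qed

lemma two_det_eq:
  fixes E :: "nat \<Rightarrow> nat \<Rightarrow> 'a::idom"
  assumes two: "(2::'a) \<noteq> 0" and n: "2*k \<le> n"
  shows "2 * (\<Sum>\<sigma> | \<sigma> permutes {1..n}. of_int (sign \<sigma>) * (\<Prod>i=1..n. E i (\<sigma> i)))
    = (\<Sum>\<sigma>\<in>paired_perms n k. of_int (sign \<sigma>) *
        (((-1)^k * (\<Prod>j<k. diag_pair E \<sigma> j - wedge_pair E \<sigma> j) +
          (\<Prod>j<k. diag_pair E \<sigma> j + wedge_pair E \<sigma> j)) * (\<Prod>i=2*k+1..n. E i (\<sigma> i))))"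
    (is "_ = ?R")
proof -
  \<comment> \<open>\<open>S\<close> is the set of pairs that contribute \<omega> when the products
    are multiplied out; the other pairs contribute \<delta>.\<close>
  define G where "G S \<sigma> = of_int (sign \<sigma>) *
      ((\<Prod>l\<in>S. wedge_pair E \<sigma> l) * (\<Prod>l\<in>{..<k} - S. diag_pair E \<sigma> l) *
       (\<Prod>l=2*k+1..n. E l (\<sigma> l)))" for S \<sigma>
  let ?P = "Pow {..<k}"
  \<comment> \<open>The product with minus signs gives \<open>(-1)^k * (-1)^card S\<close>, the
    other one gives 1. The total is 2 if \<open>k - card S\<close> is even and 0 if it is
    odd.\<close>
  let ?c = "\<lambda>S. (-1)^k * (-1)^card S + 1 :: 'a"
  have "(-1)^k * (\<Prod>j<k. diag_pair E \<sigma> j - wedge_pair E \<sigma> j) +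
          (\<Prod>j<k. diag_pair E \<sigma> j + wedge_pair E \<sigma> j)
     = (\<Sum>S\<in>?P. ?c S * ((\<Prod>l\<in>S. wedge_pair E \<sigma> l) * (\<Prod>l\<in>{..<k} - S. diag_pair E \<sigma> l)))" for \<sigma>
    using prod_add[of "{..<k}" "\<lambda>j. - wedge_pair E \<sigma> j" "diag_pair E \<sigma>"]
      prod_add[of "{..<k}" "wedge_pair E \<sigma>" "diag_pair E \<sigma>"]
    by (simp add: prod_uminus sum_distrib_left distrib_right sum.distrib mult.assoc add.commute)
  then have "?R = (\<Sum>\<sigma>\<in>paired_perms n k. \<Sum>S\<in>?P. ?c S * G S \<sigma>)"
    by (simp add: G_def sum_distrib_left sum_distrib_right mult_ac)
  also have "\<dots> = (\<Sum>S\<in>?P. ?c S * (\<Sum>\<sigma>\<in>paired_perms n k. G S \<sigma>))"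
    by (subst sum.swap) (simp add: sum_distrib_left)
  also have "\<dots> = (\<Sum>S\<in>?P. if S = {..<k} then 2 * (\<Sum>\<sigma>\<in>paired_perms n k. G S \<sigma>) else 0)"
  proof (rule sum.cong)
    fix S assume S: "S \<in> ?P"
    then have fS: "finite S" using finite_subset by auto
    \<comment> \<open>Count the pairs missing from \<open>S\<close>: with none the coefficient is 2,
      with one it is 0, and with two or more the sum over permutations is 0 whatever the
      coefficient.\<close>
    consider "S = {..<k}" | i where "{..<k} - S = {i}"
      | i j where "i \<in> {..<k} - S" "j \<in> {..<k} - S" "i \<noteq> j"
    proof (cases "S = {..<k}")
      case False
      then obtain i where i: "i \<in> {..<k} - S"
        using S by blast
      with that(2)[of i] that(3)[of i] show ?thesis
        by blast
    qed
    then show "?c S * (\<Sum>\<sigma>\<in>paired_perms n k. G S \<sigma>)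
        = (if S = {..<k} then 2 * (\<Sum>\<sigma>\<in>paired_perms n k. G S \<sigma>) else 0)"
    proof cases
      case 1
      then show ?thesis by simp
    next
      case 2
      then have "{..<k} = insert i S" "i \<notin> S"
        using S by auto
      then have k: "k = Suc (card S)"
        using fS by (metis card_insert_disjoint card_lessThan)
      have "?c S = 0"
        by (subst k) simp
      moreover have "S \<noteq> {..<k}" using 2 by auto
      ultimately show ?thesis by simp
    next
      case 3
      then show ?thesis
        using sum_paired_two_diag_pairs_eq_0[OF two n, of S i j E] S by (auto simp: G_def)
    qed
  qed simp
  also have "\<dots> = 2 * (\<Sum>\<sigma>\<in>paired_perms n k. G {..<k} \<sigma>)"
    by simp
  finally show ?thesis
    using det_eq_sum_wedge_pairs[OF n, of E] by (simp add: G_def)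
qed

section \<open>Tensor rank of the determinant\<close>

lemma sum_fun_apply: "(\<Sum>i\<in>A. f i) x = (\<Sum>i\<in>A. f i x)"
  for f :: "'i \<Rightarrow> 'a \<Rightarrow> 'b::comm_monoid_add"
  by (induction A rule: infinite_finite_induct) auto

text \<open>Enumerating \<open>I\<close> by \<open>{1..card I}\<close> gives a witness for the
  \<open>LEAST\<close>. The witness yields the bound and also shows that the minimum is
  attained.\<close>

lemma tensor_rank_le_card:
  assumes "finite I" "\<And>p j. p \<in> I \<Longrightarrow> j \<in> {1..d} \<Longrightarrow> w p j \<in> W j"
    and "T = (\<Sum>p\<in>I. pure_tensor d (w p))"
  shows "tensor_rank W d T \<le> card I"
    and "\<exists>w. (\<forall>i\<in>{1..tensor_rank W d T}. \<forall>j\<in>{1..d}. w i j \<in> W j) \<and>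
             T = (\<Sum>i = 1..tensor_rank W d T. pure_tensor d (w i))"
proof -
  let ?P = "\<lambda>r. \<exists>w. (\<forall>i\<in>{1..r}. \<forall>j\<in>{1..d}. w i j \<in> W j) \<and>
             T = (\<Sum>i = 1..r. pure_tensor d (w i))"
  obtain h where h: "bij_betw h {1..card I} I"
    using assms(1) by (metis ex_bij_betw_nat_finite_1)
  have P: "?P (card I)"
    using assms(2) bij_betwE[OF h] sum.reindex_bij_betw[OF h, of "\<lambda>p. pure_tensor d (w p)"]
    by (intro exI[of _ "\<lambda>i. w (h i)"]) (auto simp: assms(3))
  show "tensor_rank W d T \<le> card I"
    unfolding tensor_rank_def using P by (rule Least_le)
  show "?P (tensor_rank W d T)"
    unfolding tensor_rank_def using P by (rule LeastI)
qed

text \<open>Slot 1 absorbs the scalar, so coefficients in a decomposition do not increase the number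
  of pure tensors.\<close>

lemma scale_fun_pure_tensor:
  assumes "d > 0"
  shows "scale_fun c (pure_tensor d w) = pure_tensor d (w(1 := scale_fun c (w 1)))"
proof -
  have "{1..d} = insert 1 {2..d}"
    using assms by auto
  then show ?thesis
    by (auto simp: scale_fun_def pure_tensor_def fun_eq_iff mult.assoc intro!: prod.cong)
qed

section \<open>The dual space as a space of functions\<close>

lemma vector_space_scale_fun: "vector_space (scale_fun :: 'k::field \<Rightarrow> ('v \<Rightarrow> 'k) \<Rightarrow> _)"
  by unfold_locales (auto simp: scale_fun_def fun_eq_iff algebra_simps)

lemma dual_space_add_scale:
  assumes "\<phi> \<in> dual_space scale" "\<psi> \<in> dual_space scale"
  shows "(\<lambda>v. \<phi> v + c * \<psi> v) \<in> dual_space scale"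
  using assms by (simp add: dual_space_def Vector_Spaces.linear_iff algebra_simps)

lemma dual_space_diff_scale:
  assumes "\<phi> \<in> dual_space scale" "\<psi> \<in> dual_space scale"
  shows "(\<lambda>v. \<phi> v - c * \<psi> v) \<in> dual_space scale"
  using dual_space_add_scale[OF assms, of "-c"] by simp

lemma dual_space_scale:
  assumes "\<phi> \<in> dual_space scale"
  shows "scale_fun c \<phi> \<in> dual_space scale"
  using dual_space_add_scale[OF assms assms, of "c - 1"] by (simp add: scale_fun_def algebra_simps)

lemma dual_basis_mem:
  assumes "dual_basis scale n e" "a \<in> {1..n}"
  shows "e a \<in> dual_space scale"
proof -
  interpret F: vector_space scale_fun by (rule vector_space_scale_fun)
  show ?thesis
    using assms F.span_superset[of "e ` {1..n}"] by (auto simp: dual_basis_def)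
qed

lemma det_tensor_apply:
  "det_tensor n e x = (\<Sum>\<sigma> | \<sigma> permutes {1..n}. of_int (sign \<sigma>) * (\<Prod>i=1..n. e (\<sigma> i) (x i)))"
  by (simp add: det_tensor_def sum_fun_apply scale_fun_def pure_tensor_def)

text \<open>The slots of a pair carry \<open>a + s b\<close> and \<open>a - s b\<close>, where
  \<open>a\<close> and \<open>b\<close> are the basis forms that \<sigma> assigns to them. Odd
  \<open>i\<close> is the first slot of its pair, so \<open>i+1\<close> and \<open>i-1\<close> point
  to the partner.\<close>

definition pair_form ::
    "(nat \<Rightarrow> 'v \<Rightarrow> 'k::field) \<Rightarrow> nat \<Rightarrow> 'k \<Rightarrow> (nat \<Rightarrow> nat) \<Rightarrow> nat \<Rightarrow> 'v \<Rightarrow> 'k" where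
  "pair_form e k s \<sigma> i =
     (if 2*k < i then e (\<sigma> i)
      else if odd i then (\<lambda>v. e (\<sigma> i) v + s * e (\<sigma> (i+1)) v)
      else (\<lambda>v. e (\<sigma> (i-1)) v - s * e (\<sigma> i) v))"

lemma pair_form_in_dual_space:
  assumes "dual_basis scale n e" "2*k \<le> n" "\<sigma> permutes {1..n}" "i \<in> {1..n}"
  shows "pair_form e k s \<sigma> i \<in> dual_space scale"
proof -
  have e: "e (\<sigma> j) \<in> dual_space scale" if "j \<in> {1..n}" for j
    using that permutes_in_image[OF assms(3)] by (intro dual_basis_mem[OF assms(1)]) blast
  have "i + 1 \<in> {1..n}" if "odd i" "i \<le> 2*k"
    using that assms(2) by simp presburger
  moreover have "i - 1 \<in> {1..n}" if "even i"
    using that assms(4) by (auto elim!: evenE)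
  ultimately show ?thesis
    using assms(4) by (auto simp: pair_form_def intro!: e dual_space_add_scale dual_space_diff_scale)
qed

text \<open>With \<open>s * s = 1\<close>, \<open>(a + s b) \<otimes> (a - s b)\<close> equals
  \<open>(a \<otimes> a - b \<otimes> b) - s (a \<otimes> b - b \<otimes> a)\<close>, which is
  \<open>\<delta> - s \<omega>\<close>.\<close>

lemma pure_tensor_pair_form:
  fixes s :: "'k::field"
  assumes "2*k \<le> n" "s * s = 1"
  shows "pure_tensor n (pair_form e k s \<sigma>) x =
    (\<Prod>j<k. diag_pair (\<lambda>i a. e a (x i)) \<sigma> j - s * wedge_pair (\<lambda>i a. e a (x i)) \<sigma> j) *
    (\<Prod>i=2*k+1..n. e (\<sigma> i) (x i))"
proof -
  have "pair_form e k s \<sigma> (2*j+1) (x (2*j+1)) * pair_form e k s \<sigma> (2*j+2) (x (2*j+2))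
    = diag_pair (\<lambda>i a. e a (x i)) \<sigma> j - s * wedge_pair (\<lambda>i a. e a (x i)) \<sigma> j" (is "?l = ?r")
    if "j < k" for j
  proof -
    let ?E = "\<lambda>i a. e (\<sigma> a) (x i)"
    have "?l = (?E (2*j+1) (2*j+1) + s * ?E (2*j+1) (2*j+2)) * (?E (2*j+2) (2*j+1) - s * ?E (2*j+2) (2*j+2))"
      using that by (simp add: pair_form_def)
    also have "\<dots> = ?E (2*j+1) (2*j+1) * ?E (2*j+2) (2*j+1)
         - (s * s) * (?E (2*j+1) (2*j+2) * ?E (2*j+2) (2*j+2))
         - s * (?E (2*j+1) (2*j+1) * ?E (2*j+2) (2*j+2) - ?E (2*j+1) (2*j+2) * ?E (2*j+2) (2*j+1))"
      by (simp only: algebra_simps)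
    also have "\<dots> = ?r"
      unfolding assms(2) by (simp add: wedge_pair_def diag_pair_def)
    finally show ?thesis .
  qed
  then have p: "(\<Prod>j<k. pair_form e k s \<sigma> (2*j+1) (x (2*j+1)) * pair_form e k s \<sigma> (2*j+2) (x (2*j+2)))
      = (\<Prod>j<k. diag_pair (\<lambda>i a. e a (x i)) \<sigma> j - s * wedge_pair (\<lambda>i a. e a (x i)) \<sigma> j)"
    by (intro prod.cong) auto
  have "(\<Prod>i=2*k+1..n. pair_form e k s \<sigma> i (x i)) = (\<Prod>i=2*k+1..n. e (\<sigma> i) (x i))"
    by (intro prod.cong) (auto simp: pair_form_def)
  then show ?thesis
    unfolding pure_tensor_def prod_pairs[OF assms(1)] p by simp
qed

text \<open>This is \<open>two_det_eq\<close> at every argument, divided by 2. \<open>True\<close>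
  tags the product of the \<open>\<delta> - \<omega>\<close> with its weight \<open>(-1)^k\<close>,
  \<open>False\<close> that of the \<open>\<delta> + \<omega>\<close>.\<close>

lemma det_tensor_decomposition:
  fixes e :: "nat \<Rightarrow> 'v \<Rightarrow> 'k::field"
  assumes two: "(2::'k) \<noteq> 0" and k: "2*k \<le> n"
  shows "det_tensor n e = (\<Sum>(\<sigma>, s)\<in>paired_perms n k \<times> {True, False}.
     scale_fun (of_int (sign \<sigma>) * (if s then (-1)^k else 1) / 2)
       (pure_tensor n (pair_form e k (if s then 1 else -1) \<sigma>)))" (is "_ = ?R")
proof
  fix x
  define E where "E = (\<lambda>(i::nat) a. e a (x i))"
  let ?rest = "\<lambda>\<sigma>. \<Prod>i=2*k+1..n. E i (\<sigma> i)"
  have "?R x = (\<Sum>\<sigma>\<in>paired_perms n k.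
      (of_int (sign \<sigma>) * (-1)^k / 2) * ((\<Prod>j<k. diag_pair E \<sigma> j - wedge_pair E \<sigma> j) * ?rest \<sigma>)
    + (of_int (sign \<sigma>) / 2) * ((\<Prod>j<k. diag_pair E \<sigma> j + wedge_pair E \<sigma> j) * ?rest \<sigma>))"
    by (simp add: sum_fun_apply scale_fun_def pure_tensor_pair_form[OF k] E_def
        flip: sum.cartesian_product)
  then have "2 * ?R x = (\<Sum>\<sigma>\<in>paired_perms n k. of_int (sign \<sigma>) *
        (((-1)^k * (\<Prod>j<k. diag_pair E \<sigma> j - wedge_pair E \<sigma> j) +
          (\<Prod>j<k. diag_pair E \<sigma> j + wedge_pair E \<sigma> j)) * ?rest \<sigma>))"
    using two by (simp only: sum_distrib_left) (intro sum.cong refl, simp add: field_simps)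
  also have "\<dots> = 2 * det_tensor n e x"
    unfolding two_det_eq[OF two k, symmetric] det_tensor_apply by (simp add: E_def)
  finally show "det_tensor n e x = ?R x"
    using two by simp
qed

text \<open>Each of the \<open>n! / 2^k\<close> paired permutations costs two pure tensors. The
  second claim keeps a decomposition of minimal length for the Chow rank, which only evaluates its
  factors.\<close>

lemma tensor_rank_det_tensor:
  fixes e :: "nat \<Rightarrow> 'v::ab_group_add \<Rightarrow> 'k::field"
  assumes two: "(2::'k) \<noteq> 0" and "n > 0" and k: "2*k \<le> n" and basis: "dual_basis scale n e"
  defines "r \<equiv> tensor_rank (\<lambda>_. dual_space scale) n (det_tensor n e)"
  shows "2^k * r \<le> 2 * fact n"
    and "\<exists>w. det_tensor n e = (\<Sum>i = 1..r. pure_tensor n (w i))"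
proof -
  define c where "c = (\<lambda>(\<sigma> :: nat \<Rightarrow> nat, s). of_int (sign \<sigma>) * (if s then (-1)^k else 1) / 2 :: 'k)"
  define f where "f = (\<lambda>(\<sigma>, s). pair_form e k (if s then 1 else -1) \<sigma>)"
  define w where "w p = (f p)(1 := scale_fun (c p) (f p 1))" for p
  let ?I = "paired_perms n k \<times> {True, False}"
  have dec: "det_tensor n e = (\<Sum>p\<in>?I. pure_tensor n (w p))"
    unfolding det_tensor_decomposition[OF two k] w_def scale_fun_pure_tensor[OF \<open>n > 0\<close>, symmetric]
    by (simp add: c_def f_def case_prod_unfold)
  have mem: "w p j \<in> dual_space scale" if "p \<in> ?I" "j \<in> {1..n}" for p j
  proof -
    have "f p i \<in> dual_space scale" if "i \<in> {1..n}" for i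
      using \<open>p \<in> ?I\<close> that pair_form_in_dual_space[OF basis k]
      by (auto simp: f_def paired_perms_def)
    then show ?thesis
      using that(2) by (auto simp: w_def intro: dual_space_scale)
  qed
  note rank = tensor_rank_le_card[of ?I n w "\<lambda>_. dual_space scale", OF _ mem dec, folded r_def]
  have "r \<le> 2 * card (paired_perms n k)"
    using rank(1) by (simp add: card_cartesian_product)
  then have "2^k * r \<le> 2^k * (2 * card (paired_perms n k))"
    by (rule mult_le_mono2)
  then show "2^k * r \<le> 2 * fact n"
    using card_paired_perms[OF k] by (simp add: mult.left_commute)
  show "\<exists>w. det_tensor n e = (\<Sum>i = 1..r. pure_tensor n (w i))"
    using rank(2) by auto
qed

section \<open>Chow rank of the determinant\<close>

text \<open>Coordinate functionals of a basis of \<open>V\<close> are combinations of the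
  \<open>e a\<close>. Regrouping the coordinate expansion of a vector gives
  \<open>x = \<Sum>a. e a x * v a\<close>, and independence of the \<open>e a\<close> makes the
  \<open>v a\<close> dual to them.\<close>

lemma dual_basis_dual_vectors:
  fixes scale :: "'k::field \<Rightarrow> 'v::ab_group_add \<Rightarrow> 'v"
  assumes "vector_space scale" "vector_space.dim scale (UNIV :: 'v set) = n" "n > 0"
    and e: "dual_basis scale n e"
  obtains v where "\<And>a b. a \<in> {1..n} \<Longrightarrow> b \<in> {1..n} \<Longrightarrow> e a (v b) = (if a = b then 1 else 0)"
proof -
  interpret V: vector_space scale by fact
  interpret F: vector_space scale_fun by (rule vector_space_scale_fun)
  obtain B where B: "V.independent B" "V.span B = UNIV" "card B = n"
    by (metis V.basis_exists assms(2) top.extremum_uniqueI)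
  \<comment> \<open>An infinite set has \<open>card\<close> 0, so positive dimension makes
    \<open>B\<close> finite.\<close>
  then have fin: "finite B"
    using \<open>n > 0\<close> card_ge_0_finite by blast
  define \<beta> where "\<beta> b = (\<lambda>x. V.representation B x b)" for b
  have "vector_space ((*) :: 'k \<Rightarrow> 'k \<Rightarrow> 'k)"
    by unfold_locales (simp_all add: algebra_simps)
  note spaces = this V.vector_space_axioms
  have lin_e: "Vector_Spaces.linear scale (*) (e a)" if "a \<in> {1..n}" for a
    using dual_basis_mem[OF e that] by (simp add: dual_space_def)
  have "\<exists>m. \<forall>x. \<beta> b x = (\<Sum>a=1..n. m a * e a x)" for b
  proof -
    have "\<beta> b \<in> dual_space scale"
      using B by (simp add: dual_space_def \<beta>_def Vector_Spaces.linear_iff V.representation_add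
          V.representation_scale spaces)
    then have "\<beta> b \<in> F.span (e ` {1..n})"
      using e by (simp add: dual_basis_def)
    then obtain u where "\<beta> b = (\<Sum>\<phi>\<in>e ` {1..n}. scale_fun (u \<phi>) \<phi>)"
      by (auto simp: F.span_finite)
    also have "\<dots> = (\<Sum>a=1..n. scale_fun (u (e a)) (e a))"
      using e by (simp add: dual_basis_def sum.reindex)
    finally show ?thesis
      by (intro exI[of _ "\<lambda>a. u (e a)"]) (simp add: sum_fun_apply scale_fun_def)
  qed
  then obtain M where M: "\<And>b x. \<beta> b x = (\<Sum>a=1..n. M b a * e a x)"
    by metis
  \<comment> \<open>The vector that collects all terms with \<open>e a x\<close> when
    \<open>\<beta> b x\<close> is replaced by its combination of the forms in the expansion of
    \<open>x\<close> over \<open>B\<close>.\<close>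
  define v where "v a = (\<Sum>b\<in>B. scale (M b a) b)" for a
  have expand: "e c x = (\<Sum>a=1..n. e c (v a) * e a x)" if c: "c \<in> {1..n}" for c x
  proof -
    interpret L: Vector_Spaces.linear scale "(*)" "e c"
      using lin_e[OF c] .
    have "e c x = e c (\<Sum>b\<in>B. scale (\<beta> b x) b)"
      using V.sum_representation_eq[of B x B] B fin by (simp add: \<beta>_def)
    also have "\<dots> = (\<Sum>b\<in>B. \<beta> b x * e c b)"
      by (simp add: L.sum L.scale)
    also have "\<dots> = (\<Sum>a=1..n. \<Sum>b\<in>B. M b a * e a x * e c b)"
      unfolding M sum_distrib_right by (rule sum.swap)
    also have "\<dots> = (\<Sum>a=1..n. e c (v a) * e a x)"
      unfolding v_def L.sum L.scale sum_distrib_right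
      by (intro sum.cong refl) (simp only: mult_ac)
    finally show ?thesis .
  qed
  have "e c (v a) = (if c = a then 1 else 0)" if c: "c \<in> {1..n}" and a: "a \<in> {1..n}" for c a
  proof -
    \<comment> \<open>The difference between the coefficients of \<open>e c\<close> in
      \<open>expand\<close> and in the trivial expression of \<open>e c\<close> by itself;
      independence forces it to be 0.\<close>
    define u where "u b = e c (v b) - (if c = b then 1 else 0)" for b
    have "(\<Sum>b=1..n. u b * e b x) = 0" for x
    proof -
      have "(\<Sum>b=1..n. u b * e b x)
          = (\<Sum>b=1..n. e c (v b) * e b x) - (\<Sum>b=1..n. if c = b then e b x else 0)"
        unfolding u_def sum_subtractf[symmetric]
        by (intro sum.cong refl) (simp add: left_diff_distrib)
      also have "(\<Sum>b=1..n. if c = b then e b x else 0) = e c x"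
        using c by simp
      finally show ?thesis
        unfolding expand[OF c, of x, symmetric] by simp
    qed
    then have "(\<Sum>b=1..n. scale_fun (u b) (e b)) = 0"
      by (simp add: fun_eq_iff sum_fun_apply scale_fun_def)
    moreover have inj: "inj_on e {1..n}"
      using e by (simp add: dual_basis_def)
    ultimately have "(\<Sum>\<phi>\<in>e ` {1..n}. scale_fun (u (inv_into {1..n} e \<phi>)) \<phi>) = 0"
      by (simp add: sum.reindex)
    then have "u (inv_into {1..n} e (e a)) = 0"
      using e a by (intro F.independentD[of "e ` {1..n}" "e ` {1..n}"]) (auto simp: dual_basis_def)
    then show ?thesis
      using inj a by (simp add: u_def)
  qed
  then show ?thesis
    using that by blast
qed

section \<open>Constants, linear forms and the generic determinant\<close>

lemma single_0_sum: "Poly_Mapping.single 0 (sum f A) = (\<Sum>a\<in>A. Poly_Mapping.single 0 (f a))"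
  by (induction A rule: infinite_finite_induct) (auto simp: single_add)

lemma single_0_mult:
  "Poly_Mapping.single 0 (a * b) =
    Poly_Mapping.single (0 :: 'm::comm_monoid_add) a * Poly_Mapping.single 0 b"
  by (simp add: mult_single)

lemma single_0_prod:
  "Poly_Mapping.single 0 (prod f A) = (\<Prod>a\<in>A. Poly_Mapping.single (0 :: 'm::comm_monoid_add) (f a))"
  for f :: "'i \<Rightarrow> 'k::comm_ring_1"
  by (induction A rule: infinite_finite_induct) (auto simp: single_0_mult single_one)

lemma homogeneous_linear_form:
  assumes "\<And>a. a \<in> A \<Longrightarrow> x a \<in> X"
  shows "homogeneous X 1 (\<Sum>a\<in>A. Poly_Mapping.single 0 (c a) * Var (x a))"
proof -
  have "\<exists>a\<in>A. m = Poly_Mapping.single (x a) 1"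
    if "m \<in> Poly_Mapping.keys (\<Sum>a\<in>A. Poly_Mapping.single 0 (c a) * Var (x a))" for m
    using that keys_sum[of "\<lambda>a. Poly_Mapping.single 0 (c a) * Var (x a)" A]
    by (auto simp: Var_def mult_single split: if_splits)
  then show ?thesis
    using assms unfolding homogeneous_def by fastforce
qed

text \<open>Evaluation at the vectors \<open>v (f j)\<close> reads off the coefficient of
  \<open>e (f 1) \<otimes> ... \<otimes> e (f n)\<close> in the tensor. The same number is the
  coefficient of the product of the variables \<open>(j, f j)\<close> once the products of linear
  forms are multiplied out.\<close>

lemma det_poly_decomposition:
  fixes w :: "nat \<Rightarrow> nat \<Rightarrow> 'v \<Rightarrow> 'k::field"
  assumes v: "\<And>a b. a \<in> {1..n} \<Longrightarrow> b \<in> {1..n} \<Longrightarrow> e a (v b) = (if a = b then 1 else 0)"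
    and T: "det_tensor n e = (\<Sum>i = 1..r. pure_tensor n (w i))"
  shows "det_poly n =
    (\<Sum>i = 1..r. \<Prod>j = 1..n. \<Sum>a = 1..n. Poly_Mapping.single 0 (w i j (v a)) * Var (j, a))"
proof -
  let ?C = "Poly_Mapping.single (0 :: nat \<times> nat \<Rightarrow>\<^sub>0 nat) :: 'k \<Rightarrow> _"
  \<comment> \<open>Multiplying out a product of sums gives choice functions that are
    \<open>undefined\<close> outside \<open>{1..n}\<close>, whereas permutations are the identity
    there. Hence the comparison with \<open>restrict \<sigma> {1..n}\<close>.\<close>
  let ?F = "{1..n} \<rightarrow>\<^sub>E {1..n}"
  let ?\<delta> = "\<lambda>\<sigma> f. if f = restrict \<sigma> {1..n} then 1 else 0 :: 'k"
  define mon :: "(nat \<Rightarrow> nat) \<Rightarrow> (nat \<times> nat, 'k) poly_in" where "mon f = (\<Prod>j=1..n. Var (j, f j))" for f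
  have coeff: "(\<Sum>i=1..r. \<Prod>j=1..n. w i j (v (f j)))
      = (\<Sum>\<sigma> | \<sigma> permutes {1..n}. of_int (sign \<sigma>) * ?\<delta> \<sigma> f)" if f: "f \<in> ?F" for f
  proof -
    have "(\<Sum>i=1..r. \<Prod>j=1..n. w i j (v (f j))) = det_tensor n e (\<lambda>j. v (f j))"
      unfolding T by (simp add: sum_fun_apply pure_tensor_def)
    also have "\<dots> = (\<Sum>\<sigma> | \<sigma> permutes {1..n}. of_int (sign \<sigma>) * (\<Prod>j=1..n. e (\<sigma> j) (v (f j))))"
      by (rule det_tensor_apply)
    also have "\<dots> = (\<Sum>\<sigma> | \<sigma> permutes {1..n}. of_int (sign \<sigma>) * ?\<delta> \<sigma> f)"
    proof (intro sum.cong refl arg_cong2[where f = times])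
      fix \<sigma> assume "\<sigma> \<in> {\<sigma>. \<sigma> permutes {1..n}}"
      then have \<sigma>: "\<sigma> j \<in> {1..n}" if "j \<in> {1..n}" for j
        using that permutes_in_image[of \<sigma> "{1..n}" j] by simp
      have "(\<Prod>j=1..n. e (\<sigma> j) (v (f j))) = (\<Prod>j=1..n. if \<sigma> j = f j then 1 else 0)"
        using f \<sigma> by (intro prod.cong v) auto
      also have "\<dots> = (if \<forall>j\<in>{1..n}. \<sigma> j = f j then 1 else 0)"
        by (auto simp: prod_zero_iff)
      also have "(\<forall>j\<in>{1..n}. \<sigma> j = f j) \<longleftrightarrow> f = restrict \<sigma> {1..n}"
        using f by (auto simp: fun_eq_iff restrict_def PiE_def extensional_def)
      finally show "(\<Prod>j=1..n. e (\<sigma> j) (v (f j))) = ?\<delta> \<sigma> f" .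
    qed
    finally show ?thesis .
  qed
  have "(\<Sum>i = 1..r. \<Prod>j = 1..n. \<Sum>a = 1..n. ?C (w i j (v a)) * Var (j, a))
      = (\<Sum>i = 1..r. \<Sum>f\<in>?F. ?C (\<Prod>j=1..n. w i j (v (f j))) * mon f)"
    by (simp add: prod_sum_PiE prod.distrib single_0_prod mon_def)
  also have "\<dots> = (\<Sum>f\<in>?F. ?C (\<Sum>i=1..r. \<Prod>j=1..n. w i j (v (f j))) * mon f)"
    by (subst sum.swap) (simp add: single_0_sum sum_distrib_right)
  also have "\<dots> = (\<Sum>f\<in>?F. \<Sum>\<sigma> | \<sigma> permutes {1..n}. ?C (of_int (sign \<sigma>) * ?\<delta> \<sigma> f) * mon f)"
    by (intro sum.cong refl) (simp only: coeff single_0_sum sum_distrib_right)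
  also have "\<dots> = (\<Sum>\<sigma> | \<sigma> permutes {1..n}. \<Sum>f\<in>?F. ?C (of_int (sign \<sigma>) * ?\<delta> \<sigma> f) * mon f)"
    by (rule sum.swap)
  \<comment> \<open>For fixed \<sigma> only the choice function that agrees with it on
    \<open>{1..n}\<close> survives.\<close>
  also have "\<dots> = (\<Sum>\<sigma> | \<sigma> permutes {1..n}. of_int (sign \<sigma>) * mon \<sigma>)"
  proof (intro sum.cong refl)
    fix \<sigma> assume "\<sigma> \<in> {\<sigma>. \<sigma> permutes {1..n}}"
    then have "restrict \<sigma> {1..n} \<in> ?F"
      using permutes_in_image[of \<sigma> "{1..n}"] by auto
    moreover have "?C (of_int (sign \<sigma>)) = of_int (sign \<sigma>)"
      by (cases \<sigma> rule: sign_cases) (simp_all add: single_one single_uminus)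
    moreover have "mon (restrict \<sigma> {1..n}) = mon \<sigma>"
      unfolding mon_def by (intro prod.cong) auto
    moreover have "?C (of_int (sign \<sigma>) * ?\<delta> \<sigma> f) * mon f
        = (if f = restrict \<sigma> {1..n} then ?C (of_int (sign \<sigma>)) * mon f else 0)" for f
      by simp
    ultimately show "(\<Sum>f\<in>?F. ?C (of_int (sign \<sigma>) * ?\<delta> \<sigma> f) * mon f) = of_int (sign \<sigma>) * mon \<sigma>"
      by (simp only: sum.delta finite_PiE finite_atLeastAtMost if_True)
  qed
  finally show ?thesis
    by (simp add: det_poly_def mon_def)
qed

theorem corollary3p1:
  fixes scale :: "'k::field \<Rightarrow> 'v::ab_group_add \<Rightarrow> 'v"
    and e :: "nat \<Rightarrow> 'v \<Rightarrow> 'k"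
    and n :: nat
  assumes "CHAR('k) \<noteq> 2"
    and "n > 0"
    and "vector_space scale"
    and "vector_space.dim scale (UNIV :: 'v set) = n"
    and "dual_basis scale n e"
  shows "chow_rank ({1..n} \<times> {1..n}) n (det_poly n :: (nat \<times> nat, 'k) poly_in)
           \<le> tensor_rank (\<lambda>_. dual_space scale) n (det_tensor n e)
       \<and> real (tensor_rank (\<lambda>_. dual_space scale) n (det_tensor n e))
           \<le> fact n / 2 powi \<lfloor>(real n - 2) / 2\<rfloor>"
proof -
  define r where "r = tensor_rank (\<lambda>_. dual_space scale) n (det_tensor n e)"
  define k where "k = n div 2"
  \<comment> \<open>If 2 were 0, the characteristic would divide 2 without being 2, hence be 1, and
    then 1 would be 0.\<close>
  have two: "(2::'k) \<noteq> 0"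
  proof
    assume "(2::'k) = 0"
    then have "CHAR('k) dvd 2"
      using of_nat_eq_0_iff_char_dvd[of 2, where 'a = 'k] by simp
    then have "CHAR('k) = 1"
      using assms(1) two_is_prime_nat prime_nat_iff by blast
    then show False
      using of_nat_CHAR[where 'a = 'k] by simp
  qed
  have k: "2*k \<le> n" by (simp add: k_def)
  note rank = tensor_rank_det_tensor[OF two assms(2) k assms(5), folded r_def]
  obtain v where v: "\<And>a b. a \<in> {1..n} \<Longrightarrow> b \<in> {1..n} \<Longrightarrow> e a (v b) = (if a = b then 1 else 0)"
    using dual_basis_dual_vectors[OF assms(3,4,2,5)] by blast
  obtain w where "det_tensor n e = (\<Sum>i = 1..r. pure_tensor n (w i))"
    using rank(2) by blast
  note dec = det_poly_decomposition[OF v this]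
  have "homogeneous ({1..n} \<times> {1..n}) 1
      (\<Sum>a = 1..n. Poly_Mapping.single 0 (w i j (v a)) * Var (j, a))" if "j \<in> {1..n}" for i j
    using that by (intro homogeneous_linear_form) auto
  then have "chow_rank ({1..n} \<times> {1..n}) n (det_poly n :: (nat \<times> nat, 'k) poly_in) \<le> r"
    unfolding chow_rank_def
    by (intro Least_le exI[of _ "\<lambda>i j. \<Sum>a = 1..n. Poly_Mapping.single 0 (w i j (v a)) * Var (j, a)"]
        conjI ballI dec)
  \<comment> \<open>The two pure tensors per permutation cost one power of 2, so the exponent is
    \<open>k - 1\<close>. It is -1 for \<open>n = 1\<close>, hence an integer exponent.\<close>
  moreover have "\<lfloor>(real n - 2) / 2\<rfloor> = int k - 1"
  proof -
    have "n = 2 * k \<or> n = 2 * k + 1"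
      unfolding k_def by presburger
    then show ?thesis
      by (intro floor_unique) auto
  qed
  moreover have "real r \<le> fact n / 2 powi (int k - 1)"
  proof -
    have "real (2^k * r) \<le> real (2 * fact n)"
      using rank(1) by (simp only: of_nat_le_iff)
    then show ?thesis
      by (simp add: power_int_diff field_simps)
  qed
  ultimately show ?thesis
    by (simp add: r_def)
qed

end
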